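(* For any integers $0 < \alpha < a$ and $0 < \beta < b$, the following formula holds: $$w_{\alpha,\beta,a,b}(t) = \sum_{i=0}^{a-\alpha-1} \sum_{j=0}^{\alpha-1} \sum_{i'=0}^{b-\beta-1} \sum_{j'=0}^{\beta-1} \binom{a}{i,j}\binom{b}{i',j'} \cdot (1+t) \cdot t^{a+b-i-j-i'-j'-2}.$$
   Context: For a $d$-dimensional polytope $\mathscr{P}$, $f_{\mathscr{P}}(t)=\sum_{i=0}^d f_i t^i$, where $f_i$ is the number of $i$-dimensional faces of $\mathscr{P}$ (the empty face is not counted; $f_d=1$). The hypersimplex is $\Delta_{k,n}=\{x\in[0,1]^n : \sum_{i=1}^n x_i=k\}$. The Schubert elementary split matroid $\mathsf{\Lambda}_{k-r,k,n-h,n}$ is the matroid of rank $k$ on $[n]$ with base polytope $\mathscr{P}(\mathsf{\Lambda}_{k-r,k,n-h,n})=\{x\in\Delta_{k,n} : \sum_{i=1}^h x_i\le r\}$ (the base polytope of a matroid is the convex hull of the indicator vectors of its bases). Define $u_{r,k,h,n}(t):=f_{\Delta_{k,n}}(t)-f_{\mathscr{P}(\mathsf{\Lambda}_{k-r,k,n-h,n})}(t)$ and, for $0<\alpha<a$ and $0<\beta<b$, $$w_{\alpha,\beta,a,b}(t):=f_{\Delta_{\alpha+\beta,a+b}}(t)-f_{\Delta_{\alpha,a}}(t)\cdot f_{\Delta_{\beta,b}}(t)-u_{\alpha,\alpha+\beta,a,a+b}(t)-u_{\beta,\alpha+\beta,b,a+b}(t).$$ Multinomial coefficients: for nonnegative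 integers $i,j,\ell$, $\binom{i+j+\ell}{i,j}:=\frac{(i+j+\ell)!}{i!\,j!\,\ell!}$. *)

theory Defs
  imports "HOL-Analysis.Analysis" "HOL-Computational_Algebra.Polynomial"
begin

(* "face_of" yields the usual faces of a polytope, including the polytope itself and {}.
   The empty face has affine dimension -1, so it is never counted below. *)

definition face_number :: "'v::euclidean_space set \<Rightarrow> nat \<Rightarrow> nat" where
  "face_number P i = card {F. F face_of P \<and> aff_dim F = int i}"

definition f_poly :: "'v::euclidean_space set \<Rightarrow> int poly" where
  "f_poly P = (\<Sum>i = 0..nat (aff_dim P). monom (int (face_number P i)) i)"

(* The hypersimplex Delta_{k,n}, with n = CARD('n). *)

definition hypersimplex :: "nat \<Rightarrow> (real ^ 'n) set" where
  "hypersimplex k = {x. (\<forall>i. 0 \<le> x $ i \<and> x $ i \<le> 1) \<and> (\<Sum>i\<in>UNIV. x $ i) = real k}"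

(* The base polytope of the Schubert elementary split matroid Lambda_{k-r,k,n-h,n}, which is the
   matroid determined by this polytope. The ground set [n] is the disjoint union of its first h
   elements, of type 'h, and the remaining n - h elements, of type 'm; thus h = CARD('h) and
   n = CARD('h) + CARD('m). *)

definition split_polytope :: "nat \<Rightarrow> nat \<Rightarrow> (real ^ ('h::finite + 'm::finite)) set" where
  "split_polytope r k = {x \<in> hypersimplex k. (\<Sum>i\<in>UNIV. x $ (Inl i :: 'h + 'm)) \<le> real r}"

(* u_{r,k,h,n} for h = CARD('h) and n = CARD('h) + CARD('m). *)

definition u_poly :: "'h::finite itself \<Rightarrow> 'm::finite itself \<Rightarrow> nat \<Rightarrow> nat \<Rightarrow> int poly" where
  "u_poly _ _ r k =
     f_poly (hypersimplex k :: (real ^ ('h + 'm)) set)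
   - f_poly (split_polytope r k :: (real ^ ('h + 'm)) set)"

(* w_{alpha,beta,a,b} for a = CARD('a) and b = CARD('b). In the last term the distinguished
   first coordinates are the b ones, whence the swapped types. *)

definition w_poly :: "'a::finite itself \<Rightarrow> 'b::finite itself \<Rightarrow> nat \<Rightarrow> nat \<Rightarrow> int poly" where
  "w_poly A B \<alpha> \<beta> =
     f_poly (hypersimplex (\<alpha> + \<beta>) :: (real ^ ('a + 'b)) set)
   - f_poly (hypersimplex \<alpha> :: (real ^ 'a) set) * f_poly (hypersimplex \<beta> :: (real ^ 'b) set)
   - u_poly A B \<alpha> (\<alpha> + \<beta>)
   - u_poly B A \<beta> (\<alpha> + \<beta>)"

(* n! / (i! j! (n-i-j)!); only meaningful for i + j \<le> n, where the division is exact. *)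

definition multinom :: "nat \<Rightarrow> nat \<Rightarrow> nat \<Rightarrow> nat" where
  "multinom n i j = fact n div (fact i * fact j * fact (n - i - j))"

end

theory Submission
  imports Defs
begin

text \<open>Write \<open>k = \<alpha> + \<beta>\<close> and cut the hypersimplex \<open>\<Delta>\<close> of sum \<open>k\<close> by the hyperplane on which the first \<open>a\<close>
  coordinates sum to \<open>\<alpha>\<close>. The two halves are the split polytopes in the definition of \<open>w\<close> (the
  second one after exchanging the two blocks of coordinates), and the slice is the product of the
  two smaller hypersimplices, so \<open>w\<close> is the sum of the \<open>f\<close>-polynomials of the halves minus those of
  \<open>\<Delta>\<close> and of the slice. A face of \<open>\<Delta>\<close> not crossing the hyperplane contributes nothing to this
  difference, whereas a crossing face of dimension \<open>d\<close> contributes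
  \<open>2 t^d + 2 t^(d-1) - t^d - t^(d-1) = (1 + t) t^(d-1)\<close>. Faces of \<open>\<Delta>\<close> arise by fixing the coordinates
  in \<open>I\<close> to 0 and those in \<open>J\<close> to 1, and such a face crosses exactly when \<open>I\<close> meets
  the two blocks in fewer than \<open>a - \<alpha>\<close> and \<open>b - \<beta>\<close> elements and \<open>J\<close> meets them in fewer than \<open>\<alpha>\<close>
  and \<open>\<beta>\<close> elements.\<close>


section \<open>Faces of intersections of polyhedra\<close>

text \<open>The empty face has dimension -1, which \<open>nat\<close> would send to 0; it is left
  out so that it does not add a spurious constant term to sums over faces.\<close>

definition nonempty_faces :: "'v::euclidean_space set \<Rightarrow> 'v set set" where
  "nonempty_faces P = {F. F face_of P \<and> F \<noteq> {}}"

lemma finite_nonempty_faces: "polyhedron P \<Longrightarrow> finite (nonempty_faces P)"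
  unfolding nonempty_faces_def by (rule finite_subset[OF _ finite_polyhedron_faces]) auto

lemma nonempty_facesD:
  assumes "F \<in> nonempty_faces P"
  shows "F face_of P" "F \<noteq> {}" "convex F"
  using assms face_of_imp_convex by (auto simp: nonempty_faces_def)

lemma of_nat_mult_monom: "of_nat k * monom (1::int) i = monom (int k) i"
  by (induction k) (simp_all add: add_monom[symmetric] distrib_right)

text \<open>Grouping the faces by dimension gives the coefficients. In this form identities between
  \<open>f\<close>-polynomials can be checked face by face.\<close>

lemma f_poly_eq_sum_faces:
  fixes P :: "'v::euclidean_space set"
  assumes "polyhedron P"
  shows "f_poly P = (\<Sum>F\<in>nonempty_faces P. monom 1 (nat (aff_dim F)))"
proof -
  have dim: "aff_dim F \<ge> 0 \<and> aff_dim F \<le> aff_dim P" if "F \<in> nonempty_faces P" for F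
    using nonempty_facesD[OF that] aff_dim_subset[of F P] face_of_imp_subset[of F P] aff_dim_negative_iff[of F]
    by linarith
  have "(\<Sum>F\<in>nonempty_faces P. monom (1::int) (nat (aff_dim F)))
      = (\<Sum>i = 0..nat (aff_dim P). \<Sum>F | F \<in> nonempty_faces P \<and> nat (aff_dim F) = i. monom 1 (nat (aff_dim F)))"
    by (rule sum.group[symmetric]) (use finite_nonempty_faces[OF assms] dim in \<open>auto intro!: nat_mono\<close>)
  also have "\<dots> = (\<Sum>i = 0..nat (aff_dim P). monom (int (face_number P i)) i)"
  proof (rule sum.cong[OF refl])
    fix i
    have "{F. F \<in> nonempty_faces P \<and> nat (aff_dim F) = i} = {F. F face_of P \<and> aff_dim F = int i}"
      using dim by (fastforce simp: nonempty_faces_def)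
    then have "card {F. F \<in> nonempty_faces P \<and> nat (aff_dim F) = i} = face_number P i"
      by (simp add: face_number_def)
    moreover have "(\<Sum>F | F \<in> nonempty_faces P \<and> nat (aff_dim F) = i. monom (1::int) (nat (aff_dim F)))
        = (\<Sum>F | F \<in> nonempty_faces P \<and> nat (aff_dim F) = i. monom 1 i)"
      by (rule sum.cong) auto
    ultimately show "(\<Sum>F | F \<in> nonempty_faces P \<and> nat (aff_dim F) = i. monom (1::int) (nat (aff_dim F)))
        = monom (int (face_number P i)) i"
      by (simp add: of_nat_mult_monom)
  qed
  finally show ?thesis unfolding f_poly_def by simp
qed

text \<open>Take the smallest face through \<open>x\<close>. If \<open>x\<close> lay on its relative
  frontier, some proper face of it would contain \<open>x\<close> and would again be a face of
  \<open>P\<close>, against minimality.\<close>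

lemma face_containing_in_rel_interior:
  fixes P :: "'v::euclidean_space set"
  assumes "polyhedron P" "x \<in> P"
  obtains F where "F face_of P" "x \<in> rel_interior F"
proof -
  define F where "F = \<Inter>{G. G face_of P \<and> x \<in> G}"
  have face: "F face_of P"
    unfolding F_def by (rule face_of_Inter) (use assms face_of_refl polyhedron_imp_convex in blast)+
  have x: "x \<in> F" by (auto simp: F_def)
  have poly: "polyhedron F" using face assms face_of_polyhedron_polyhedron by blast
  have "x \<in> rel_interior F"
  proof (rule ccontr)
    assume "x \<notin> rel_interior F"
    then have "x \<in> rel_frontier F"
      using x closure_subset by (auto simp: rel_frontier_def)
    then obtain G where "G face_of F" "G \<noteq> F" "x \<in> G"
      using rel_frontier_of_polyhedron_alt[OF poly] by auto
    then show False
      using face_of_trans[OF _ face] face_of_imp_subset[of G F] by (auto simp: F_def)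
  qed
  with face that show ?thesis by blast
qed

text \<open>A relative interior point of a face \<open>G\<close> of the intersection lies in the
  relative interiors of a face \<open>F\<close> of \<open>P\<close> and a face \<open>K\<close> of
  \<open>T\<close>. When these relative interiors meet, their intersection is the relative interior
  of \<open>F \<inter> K\<close>. Since faces of one set with meeting relative interiors coincide,
  both \<open>G = F \<inter> K\<close> and uniqueness of the pair follow.\<close>

lemma bij_betw_faces_Int:
  fixes P T :: "'v::euclidean_space set"
  assumes P: "polyhedron P" and T: "polyhedron T"
  shows "bij_betw (\<lambda>(F, K). F \<inter> K)
    {(F, K). F \<in> nonempty_faces P \<and> K \<in> nonempty_faces T \<and> rel_interior F \<inter> rel_interior K \<noteq> {}}
    (nonempty_faces (P \<inter> T))" (is "bij_betw ?f ?A ?B")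
proof (rule bij_betw_imageI)
  have ri: "rel_interior (F \<inter> K) = rel_interior F \<inter> rel_interior K" if "(F, K) \<in> ?A" for F K
    using that convex_rel_interior_inter_two[of F K] nonempty_facesD(3)[of F P] nonempty_facesD(3)[of K T] by simp
  show "inj_on ?f ?A"
  proof (rule inj_onI, clarify)
    fix F K F' K'
    assume A: "F \<in> nonempty_faces P" "K \<in> nonempty_faces T" "rel_interior F \<inter> rel_interior K \<noteq> {}"
      "F' \<in> nonempty_faces P" "K' \<in> nonempty_faces T" "rel_interior F' \<inter> rel_interior K' \<noteq> {}"
      and eq: "F \<inter> K = F' \<inter> K'"
    have "rel_interior F \<inter> rel_interior K = rel_interior F' \<inter> rel_interior K'"
      using ri[of F K] ri[of F' K'] A eq by simp
    then have "rel_interior F \<inter> rel_interior F' \<noteq> {}" "rel_interior K \<inter> rel_interior K' \<noteq> {}"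
      using A by blast+
    then show "F = F' \<and> K = K'"
      using A face_of_eq[of F P F'] face_of_eq[of K T K'] by (simp add: nonempty_faces_def)
  qed
  show "?f ` ?A = ?B"
  proof
    show "?f ` ?A \<subseteq> ?B"
    proof clarify
      fix F K
      assume FK: "F \<in> nonempty_faces P" "K \<in> nonempty_faces T" "rel_interior F \<inter> rel_interior K \<noteq> {}"
      then have "F \<inter> K \<noteq> {}" using rel_interior_subset[of F] rel_interior_subset[of K] by blast
      then show "F \<inter> K \<in> nonempty_faces (P \<inter> T)"
        using FK face_of_Int_Int[of F P K T] by (simp add: nonempty_faces_def)
    qed
    show "?B \<subseteq> ?f ` ?A"
    proof
      fix G assume "G \<in> ?B"
      note G = nonempty_facesD[OF this]
      then obtain x where x: "x \<in> rel_interior G" using rel_interior_eq_empty[of G] by auto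
      then have "x \<in> P" "x \<in> T" using face_of_imp_subset[OF G(1)] rel_interior_subset[of G] by auto
      then obtain F K where FK: "F face_of P" "x \<in> rel_interior F" "K face_of T" "x \<in> rel_interior K"
        using face_containing_in_rel_interior P T by metis
      then have A: "(F, K) \<in> ?A" by (auto simp: nonempty_faces_def)
      have "x \<in> rel_interior (F \<inter> K)" using ri[OF A] FK by blast
      then have "G = F \<inter> K"
        using face_of_eq[OF G(1) face_of_Int_Int[OF FK(1,3)]] x by blast
      then show "G \<in> ?f ` ?A" using A by (intro image_eqI[of _ _ "(F, K)"]) auto
    qed
  qed
qed

text \<open>Pairs whose relative interiors are disjoint are kept with value 0, so that the outer sum
  runs over all faces of \<open>P\<close>, whichever \<open>T\<close> is chosen.\<close>

lemma f_poly_Int: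
  fixes P T :: "'v::euclidean_space set"
  assumes "polyhedron P" and "polyhedron T"
  shows "f_poly (P \<inter> T) = (\<Sum>F\<in>nonempty_faces P. \<Sum>K\<in>nonempty_faces T.
    if rel_interior F \<inter> rel_interior K \<noteq> {} then monom 1 (nat (aff_dim (F \<inter> K))) else 0)"
proof -
  let ?A = "{(F, K). F \<in> nonempty_faces P \<and> K \<in> nonempty_faces T \<and> rel_interior F \<inter> rel_interior K \<noteq> {}}"
  have "f_poly (P \<inter> T) = (\<Sum>(F, K)\<in>?A. monom 1 (nat (aff_dim (F \<inter> K))))"
    using sum.reindex_bij_betw[OF bij_betw_faces_Int[OF assms], of "\<lambda>G. monom (1::int) (nat (aff_dim G))"]
    by (simp add: f_poly_eq_sum_faces[OF polyhedron_Int[OF assms]] case_prod_unfold)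
  also have "\<dots> = (\<Sum>(F, K)\<in>nonempty_faces P \<times> nonempty_faces T.
    if rel_interior F \<inter> rel_interior K \<noteq> {} then monom 1 (nat (aff_dim (F \<inter> K))) else 0)"
    using finite_nonempty_faces[OF assms(1)] finite_nonempty_faces[OF assms(2)]
    by (intro sum.mono_neutral_cong_left finite_cartesian_product) (auto simp: case_prod_unfold subset_iff)
  finally show ?thesis by (simp add: sum.cartesian_product)
qed

section \<open>Cutting a polyhedron along a hyperplane\<close>

lemma ex_inner_eq:
  fixes c :: "'v::euclidean_space"
  assumes "c \<noteq> 0"
  shows "\<exists>x. c \<bullet> x = d"
  using assms by (intro exI[of _ "(d / (c \<bullet> c)) *\<^sub>R c"]) simp

lemma nonempty_faces_halfspace_le:
  fixes c :: "'v::euclidean_space"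
  assumes "c \<noteq> 0"
  shows "nonempty_faces {x. c \<bullet> x \<le> d} = {{x. c \<bullet> x \<le> d}, {x. c \<bullet> x = d}}"
proof -
  have "{x. c \<bullet> x = d} \<noteq> {}" "{x. c \<bullet> x \<le> d} \<noteq> {}"
    using ex_inner_eq[OF assms, of d] by auto
  then show ?thesis unfolding nonempty_faces_def face_of_halfspace_le by blast
qed

lemma nonempty_faces_halfspace_ge:
  fixes c :: "'v::euclidean_space"
  assumes "c \<noteq> 0"
  shows "nonempty_faces {x. c \<bullet> x \<ge> d} = {{x. c \<bullet> x \<ge> d}, {x. c \<bullet> x = d}}"
proof -
  have "{x. c \<bullet> x = d} \<noteq> {}" "{x. c \<bullet> x \<ge> d} \<noteq> {}"
    using ex_inner_eq[OF assms, of d] by auto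
  then show ?thesis unfolding nonempty_faces_def face_of_halfspace_ge by blast
qed

lemma nonempty_faces_hyperplane:
  fixes c :: "'v::euclidean_space"
  assumes "c \<noteq> 0"
  shows "nonempty_faces {x. c \<bullet> x = d} = {{x. c \<bullet> x = d}}"
  using ex_inner_eq[OF assms, of d]
  unfolding nonempty_faces_def face_of_affine_eq[OF affine_hyperplane] by blast

lemma rel_interior_halfspaces:
  fixes c :: "'v::euclidean_space"
  assumes "c \<noteq> 0"
  shows "rel_interior {x. c \<bullet> x \<le> d} = {x. c \<bullet> x < d}"
    and "rel_interior {x. c \<bullet> x \<ge> d} = {x. c \<bullet> x > d}"
    and "rel_interior {x. c \<bullet> x = d} = {x. c \<bullet> x = d}"
proof -
  have "\<exists>x. c \<bullet> x < d" "\<exists>x. c \<bullet> x > d"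
    using ex_inner_eq[OF assms, of "d - 1"] ex_inner_eq[OF assms, of "d + 1"]
    by (metis diff_less_eq less_add_one, metis less_add_one)
  then show "rel_interior {x. c \<bullet> x \<le> d} = {x. c \<bullet> x < d}" "rel_interior {x. c \<bullet> x \<ge> d} = {x. c \<bullet> x > d}"
    using assms by (subst rel_interior_nonempty_interior; simp)+
  show "rel_interior {x. c \<bullet> x = d} = {x. c \<bullet> x = d}"
    by (rule rel_interior_affine) (rule affine_hyperplane)
qed

text \<open>For convex \<open>F\<close> this amounts to the relative interior meeting the hyperplane
  while \<open>F\<close> is not contained in it.\<close>

definition crosses :: "'v::euclidean_space \<Rightarrow> real \<Rightarrow> 'v set \<Rightarrow> bool" where
  "crosses c d F \<longleftrightarrow> (\<exists>x\<in>F. c \<bullet> x < d) \<and> (\<exists>x\<in>F. c \<bullet> x > d)"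

text \<open>A convex set and its relative interior have the same closure, and an open set meets a
  set exactly when it meets its closure.\<close>

lemma rel_interior_meets_open_iff:
  fixes F :: "'v::euclidean_space set"
  assumes "convex F" "open U"
  shows "rel_interior F \<inter> U \<noteq> {} \<longleftrightarrow> F \<inter> U \<noteq> {}"
  using open_Int_closure_eq_empty[OF assms(2), of F] open_Int_closure_eq_empty[OF assms(2), of "rel_interior F"]
  by (simp add: convex_closure_rel_interior[OF assms(1)] Int_commute)

lemma rel_interior_meets_lt_iff:
  fixes c :: "'v::euclidean_space"
  assumes "convex F"
  shows "rel_interior F \<inter> {x. c \<bullet> x < d} \<noteq> {} \<longleftrightarrow> (\<exists>x\<in>F. c \<bullet> x < d)"
  unfolding rel_interior_meets_open_iff[OF assms open_halfspace_lt] by blast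

lemma rel_interior_meets_gt_iff:
  fixes c :: "'v::euclidean_space"
  assumes "convex F"
  shows "rel_interior F \<inter> {x. c \<bullet> x > d} \<noteq> {} \<longleftrightarrow> (\<exists>x\<in>F. c \<bullet> x > d)"
  unfolding rel_interior_meets_open_iff[OF assms open_halfspace_gt] by blast

text \<open>Intersecting a convex set with an open set that it meets keeps the dimension; the closed
  half is squeezed between the open half and \<open>F\<close>.\<close>

lemma aff_dim_Int_halfspace_le:
  fixes c :: "'v::euclidean_space"
  assumes "convex F" "\<exists>x\<in>F. c \<bullet> x < d"
  shows "aff_dim (F \<inter> {x. c \<bullet> x \<le> d}) = aff_dim F"
proof (rule antisym)
  have "aff_dim F = aff_dim (F \<inter> {x. c \<bullet> x < d})"
    using aff_dim_convex_Int_open[OF assms(1) open_halfspace_lt] assms(2) by fastforce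
  also have "\<dots> \<le> aff_dim (F \<inter> {x. c \<bullet> x \<le> d})" by (rule aff_dim_subset) auto
  finally show "aff_dim F \<le> aff_dim (F \<inter> {x. c \<bullet> x \<le> d})" .
qed (rule aff_dim_subset, auto)

lemma aff_dim_Int_halfspace_ge:
  fixes c :: "'v::euclidean_space"
  assumes "convex F" "\<exists>x\<in>F. c \<bullet> x > d"
  shows "aff_dim (F \<inter> {x. c \<bullet> x \<ge> d}) = aff_dim F"
  using aff_dim_Int_halfspace_le[of F "-c" "-d"] assms by simp

text \<open>A segment of \<open>F\<close> that ends in a relative interior point can be prolonged a
  little inside \<open>F\<close>. Starting below the hyperplane and reaching it at \<open>x\<close>,
  it continues above.\<close>

lemma rel_interior_hyperplane_prolong:
  fixes c :: "'v::euclidean_space"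
  assumes "convex F" "x \<in> rel_interior F" "c \<bullet> x = d" "y \<in> F" "c \<bullet> y < d"
  shows "\<exists>z\<in>F. c \<bullet> z > d"
proof -
  obtain e where e: "e > 1" "(1 - e) *\<^sub>R y + e *\<^sub>R x \<in> F"
    using convex_rel_interior_iff[of F x] assms by auto
  have "c \<bullet> ((1 - e) *\<^sub>R y + e *\<^sub>R x) = d + (e - 1) * (d - c \<bullet> y)"
    using assms(3) by (simp add: inner_add_right algebra_simps)
  moreover have "(e - 1) * (d - c \<bullet> y) > 0" using e assms by simp
  ultimately show ?thesis using e by (intro bexI[of _ "(1 - e) *\<^sub>R y + e *\<^sub>R x"]) auto
qed

text \<open>The relative interior also has points on both sides, and it is connected, so the
  intermediate value theorem applies.\<close>

lemma crosses_imp_rel_interior_meets: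
  fixes c :: "'v::euclidean_space"
  assumes "convex F" "crosses c d F"
  shows "rel_interior F \<inter> {x. c \<bullet> x = d} \<noteq> {}"
proof -
  obtain x y where xy: "x \<in> rel_interior F" "c \<bullet> x < d" "y \<in> rel_interior F" "c \<bullet> y > d"
    using assms rel_interior_meets_lt_iff[OF assms(1), of c d] rel_interior_meets_gt_iff[OF assms(1), of d c]
    unfolding crosses_def by blast
  have "connected (rel_interior F)" using assms convex_connected convex_rel_interior by blast
  then obtain z where "z \<in> rel_interior F" "c \<bullet> z = d"
    using connected_ivt_hyperplane[OF _ xy(1,3), of c d] xy by auto
  then show ?thesis by blast
qed

lemma rel_interior_meets_noncrossing:
  fixes c :: "'v::euclidean_space"
  assumes "convex F" "rel_interior F \<inter> {x. c \<bullet> x = d} \<noteq> {}" "\<not> crosses c d F"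
  shows "F \<subseteq> {x. c \<bullet> x = d}"
proof -
  obtain x where x: "x \<in> rel_interior F" "c \<bullet> x = d" using assms by blast
  have "\<not> c \<bullet> y < d" if "y \<in> F" for y
    using rel_interior_hyperplane_prolong[OF assms(1) x that] that assms(3) by (auto simp: crosses_def)
  \<comment> \<open>Passing to \<open>-c\<close> and \<open>-d\<close> exchanges the two
    sides.\<close>
  moreover have "\<not> c \<bullet> y > d" if "y \<in> F" for y
    using rel_interior_hyperplane_prolong[of F x "-c" "-d" y] x that assms(1,3) by (auto simp: crosses_def)
  ultimately show ?thesis by force
qed

text \<open>The hyperplane lowers the dimension of the affine hull by one. The section of
  \<open>F\<close> contains a nonempty relatively open part of the section of the hull, hence has
  the same dimension as the latter.\<close>

lemma aff_dim_Int_hyperplane_rel_interior: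
  fixes c :: "'v::euclidean_space"
  assumes "rel_interior F \<inter> {x. c \<bullet> x = d} \<noteq> {}" "\<not> F \<subseteq> {x. c \<bullet> x = d}"
  shows "aff_dim (F \<inter> {x. c \<bullet> x = d}) = aff_dim F - 1"
proof -
  let ?H = "{x. c \<bullet> x = d}" and ?A = "affine hull F"
  have hull: "aff_dim (?A \<inter> ?H) = aff_dim F - 1"
    using aff_dim_affine_Int_hyperplane[OF affine_affine_hull, of F c d] assms rel_interior_subset hull_subset[of F affine]
    by (smt (verit) IntI aff_dim_affine_hull disjoint_iff subset_eq)
  have "openin (top_of_set (?A \<inter> ?H)) (rel_interior F \<inter> ?H)"
    using openin_rel_interior[of F] unfolding openin_open by blast
  then have "aff_dim (rel_interior F \<inter> ?H) = aff_dim (?A \<inter> ?H)"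
    using aff_dim_openin affine_Int[OF affine_affine_hull affine_hyperplane] assms by blast
  moreover have "aff_dim (rel_interior F \<inter> ?H) \<le> aff_dim (F \<inter> ?H)"
    by (intro aff_dim_subset Int_mono rel_interior_subset order_refl)
  moreover have "aff_dim (F \<inter> ?H) \<le> aff_dim (?A \<inter> ?H)"
    by (intro aff_dim_subset Int_mono hull_subset order_refl)
  ultimately show ?thesis using hull by simp
qed

text \<open>This makes the natural number subtraction in the exponent
  \<open>nat (aff_dim F) - 1\<close> a genuine one.\<close>

lemma crosses_aff_dim_pos:
  assumes "crosses c d F"
  shows "aff_dim F > 0"
proof -
  obtain x y where "x \<in> F" "y \<in> F" "x \<noteq> y" using assms by (force simp: crosses_def)
  then have "\<not> (\<exists>a. F = {a})" "F \<noteq> {}" by auto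
  then have "aff_dim F \<noteq> 0" "\<not> aff_dim F < 0" using aff_dim_eq_0[of F] aff_dim_negative_iff[of F] by blast+
  then show ?thesis by linarith
qed

text \<open>By \<open>f_poly_Int\<close> all terms become sums over the faces of \<open>P\<close>.
  Each half contributes the terms of the slice once; one copy is the slice on the right-hand side,
  and the remaining identity \<open>loc\<close> is checked for each face separately.\<close>

lemma f_poly_cut:
  fixes c :: "'v::euclidean_space"
  assumes P: "polyhedron P" and c: "c \<noteq> 0"
  shows "f_poly (P \<inter> {x. c \<bullet> x \<le> d}) + f_poly (P \<inter> {x. c \<bullet> x \<ge> d})
    = f_poly P + f_poly (P \<inter> {x. c \<bullet> x = d})
      + (\<Sum>F | F \<in> nonempty_faces P \<and> crosses c d F. [:1, 1:] * monom 1 (nat (aff_dim F) - 1))"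
proof -
  let ?X = "\<lambda>T. monom (1::int) (nat (aff_dim T))"
  let ?lt = "{x. c \<bullet> x < d}" and ?gt = "{x. c \<bullet> x > d}" and ?H = "{x. c \<bullet> x = d}"
  let ?le = "{x. c \<bullet> x \<le> d}" and ?ge = "{x. c \<bullet> x \<ge> d}"
  let ?i = "\<lambda>F (U::'v set) K. if rel_interior F \<inter> U \<noteq> {} then ?X (F \<inter> K) else 0"
  note ri = rel_interior_halfspaces[OF c]
  \<comment> \<open>These points show that each half-space differs from its boundary, so that the
    sum over its two faces really has two terms.\<close>
  obtain x y where "c \<bullet> x = d - 1" "c \<bullet> y = d + 1" using ex_inner_eq[OF c] by metis
  then have "x \<in> ?le" "x \<notin> ?H" "y \<in> ?ge" "y \<notin> ?H" by auto
  then have ne: "?le \<noteq> ?H" "?ge \<noteq> ?H" by metis+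
  have le: "f_poly (P \<inter> ?le) = (\<Sum>F\<in>nonempty_faces P. ?i F ?lt ?le + ?i F ?H ?H)"
    using ne by (simp add: f_poly_Int[OF P polyhedron_halfspace_le] nonempty_faces_halfspace_le[OF c] ri)
  have ge: "f_poly (P \<inter> ?ge) = (\<Sum>F\<in>nonempty_faces P. ?i F ?gt ?ge + ?i F ?H ?H)"
    using ne by (simp add: f_poly_Int[OF P polyhedron_halfspace_ge] nonempty_faces_halfspace_ge[OF c] ri)
  have eq: "f_poly (P \<inter> ?H) = (\<Sum>F\<in>nonempty_faces P. ?i F ?H ?H)"
    unfolding f_poly_Int[OF P polyhedron_hyperplane] nonempty_faces_hyperplane[OF c] by (simp add: ri)
  have loc: "?i F ?lt ?le + ?i F ?gt ?ge + ?i F ?H ?H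
      = ?X F + (if crosses c d F then [:1, 1:] * monom 1 (nat (aff_dim F) - 1) else 0)"
    if "F \<in> nonempty_faces P" for F
  proof -
    have F: "convex F" "F \<noteq> {}" using nonempty_facesD[OF that] by auto
    have l: "?i F ?lt ?le = (if \<exists>x\<in>F. c \<bullet> x < d then ?X F else 0)"
      using aff_dim_Int_halfspace_le[OF F(1)] by (simp add: rel_interior_meets_lt_iff[OF F(1)])
    have g: "?i F ?gt ?ge = (if \<exists>x\<in>F. c \<bullet> x > d then ?X F else 0)"
      using aff_dim_Int_halfspace_ge[OF F(1)] by (simp add: rel_interior_meets_gt_iff[OF F(1)])
    show ?thesis
    proof (cases "crosses c d F")
      case True
      \<comment> \<open>With \<open>d\<close> the dimension of \<open>F\<close>, the left side is 2
        t^d + t^(d-1), which is t^d + (1 + t) t^(d-1).\<close>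
      have "aff_dim (F \<inter> ?H) = aff_dim F - 1"
        using aff_dim_Int_hyperplane_rel_interior[OF crosses_imp_rel_interior_meets[OF F(1) True]] True
        by (force simp: crosses_def)
      moreover have nat_pred: "nat (aff_dim F - 1) = nat (aff_dim F) - 1" by arith
      ultimately have "?i F ?H ?H = monom 1 (nat (aff_dim F) - 1)"
        using crosses_imp_rel_interior_meets[OF F(1) True] by (simp add: nat_pred)
      moreover have "?X F = monom 1 (Suc (nat (aff_dim F) - 1))"
        using crosses_aff_dim_pos[OF True] by simp
      ultimately show ?thesis
        using True by (simp only: l g) (simp add: crosses_def monom_Suc)
    next
      case False
      show ?thesis
      proof (cases "rel_interior F \<inter> ?H = {}")
        case True
        \<comment> \<open>Here \<open>F\<close> has points strictly on exactly one side, although it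
          may touch the hyperplane in its relative frontier; just one of the two half-space terms
          survives.\<close>
        have "\<exists>x\<in>rel_interior F. True" using F rel_interior_eq_empty by blast
        then have "(\<exists>x\<in>F. c \<bullet> x < d) \<noteq> (\<exists>x\<in>F. c \<bullet> x > d)"
          using False True rel_interior_subset[of F] unfolding crosses_def
          by (smt (verit) disjoint_iff mem_Collect_eq subsetD)
        then show ?thesis using True False by (simp only: l g) auto
      next
        case meets: False
        \<comment> \<open>Now \<open>F\<close> lies in the hyperplane and only the hyperplane term
          survives.\<close>
        then have "F \<subseteq> ?H" using rel_interior_meets_noncrossing[OF F(1) _ False] by blast
        then have "F \<inter> ?H = F" "\<not> (\<exists>x\<in>F. c \<bullet> x < d)" "\<not> (\<exists>x\<in>F. c \<bullet> x > d)" by auto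
        then show ?thesis using meets False by (simp only: l g) auto
      qed
    qed
  qed
  have "f_poly (P \<inter> ?le) + f_poly (P \<inter> ?ge)
      = (\<Sum>F\<in>nonempty_faces P. ?i F ?lt ?le + ?i F ?gt ?ge + ?i F ?H ?H) + f_poly (P \<inter> ?H)"
    unfolding le ge eq by (simp only: sum.distrib add.assoc add.commute add.left_commute)
  also have "(\<Sum>F\<in>nonempty_faces P. ?i F ?lt ?le + ?i F ?gt ?ge + ?i F ?H ?H)
      = f_poly P + (\<Sum>F\<in>nonempty_faces P. if crosses c d F then [:1, 1:] * monom 1 (nat (aff_dim F) - 1) else 0)"
    by (simp only: loc sum.distrib f_poly_eq_sum_faces[OF P] cong: sum.cong)
  finally show ?thesis
    unfolding sum.inter_filter[OF finite_nonempty_faces[OF P]] by (simp only: add.assoc add.commute add.left_commute)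
qed

section \<open>Faces of the cube\<close>

definition cube_face :: "'n set \<Rightarrow> 'n set \<Rightarrow> (real ^ 'n) set" where
  "cube_face I J = {x. (\<forall>i. 0 \<le> x $ i \<and> x $ i \<le> 1) \<and> (\<forall>i\<in>I. x $ i = 0) \<and> (\<forall>i\<in>J. x $ i = 1)}"

text \<open>The affine hull of \<open>cube_face I J\<close> for disjoint \<open>I\<close> and
  \<open>J\<close>; likewise \<open>cube_face_interior\<close> is then its relative
  interior.\<close>

definition cube_face_hull :: "'n set \<Rightarrow> 'n set \<Rightarrow> (real ^ 'n) set" where
  "cube_face_hull I J = {x. (\<forall>i\<in>I. x $ i = 0) \<and> (\<forall>i\<in>J. x $ i = 1)}"

definition cube_face_interior :: "'n set \<Rightarrow> 'n set \<Rightarrow> (real ^ 'n) set" where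
  "cube_face_interior I J = cube_face_hull I J \<inter> {x. \<forall>i\<in>- (I \<union> J). 0 < x $ i \<and> x $ i < 1}"

lemma cube_face_eq_cbox: "cube_face {} {} = (cbox 0 1 :: (real ^ 'n) set)"
  by (auto simp: cube_face_def mem_box_cart)

lemma polyhedron_cube: "polyhedron (cube_face {} {} :: (real ^ 'n) set)"
  unfolding cube_face_eq_cbox by (intro polytope_imp_polyhedron polytope_interval)

lemma affine_cube_face_hull: "affine (cube_face_hull I J)"
  unfolding affine_def cube_face_hull_def by simp

lemma cube_face_subset_hull: "cube_face I J \<subseteq> cube_face_hull I J"
  by (auto simp: cube_face_def cube_face_hull_def)

lemma cube_face_interior_subset: "cube_face_interior I J \<subseteq> (cube_face I J :: (real ^ 'n) set)"
proof
  fix x :: "real ^ 'n" assume x: "x \<in> cube_face_interior I J"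
  have "0 \<le> x $ i \<and> x $ i \<le> 1" for i
    using x unfolding cube_face_interior_def cube_face_hull_def
    by (cases "i \<in> I \<union> J") (auto simp: less_imp_le)
  then show "x \<in> cube_face I J"
    using x by (auto simp: cube_face_interior_def cube_face_hull_def cube_face_def)
qed

lemma openin_cube_face_interior:
  "openin (top_of_set (cube_face_hull I J)) (cube_face_interior I J :: (real ^ 'n) set)"
proof -
  have "open (\<Inter>i\<in>- (I \<union> J). {x :: real ^ 'n. 0 < x $ i} \<inter> {x. x $ i < 1})"
    by (intro open_INT ballI open_Int open_halfspace_component_lt_cart open_halfspace_component_gt_cart) auto
  also have "(\<Inter>i\<in>- (I \<union> J). {x :: real ^ 'n. 0 < x $ i} \<inter> {x. x $ i < 1})
      = {x. \<forall>i\<in>- (I \<union> J). 0 < x $ i \<and> x $ i < 1}" by auto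
  finally show ?thesis unfolding cube_face_interior_def openin_open by blast
qed

text \<open>The set is relatively open in an affine space containing the affine hull of the face, so
  it is relatively open in that hull too.\<close>

lemma cube_face_interior_subset_rel_interior:
  "cube_face_interior I J \<subseteq> rel_interior (cube_face I J :: (real ^ 'n) set)"
proof -
  have "affine hull (cube_face I J :: (real ^ 'n) set) \<subseteq> cube_face_hull I J"
    using affine_cube_face_hull cube_face_subset_hull by (rule hull_minimal[rotated])
  moreover have "cube_face_interior I J \<subseteq> affine hull (cube_face I J :: (real ^ 'n) set)"
    using cube_face_interior_subset hull_subset by fast
  ultimately have "openin (top_of_set (affine hull (cube_face I J))) (cube_face_interior I J :: (real ^ 'n) set)"
    using openin_cube_face_interior openin_subset_trans by blast
  then show ?thesis
    using cube_face_interior_subset by (intro rel_interior_maximal) auto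
qed

definition cube_face_point :: "'n set \<Rightarrow> 'n set \<Rightarrow> ('n \<Rightarrow> real) \<Rightarrow> real ^ 'n" where
  "cube_face_point I J s = (\<chi> i. if i \<in> I then 0 else if i \<in> J then 1 else s i)"

lemma cube_face_point_in_interior:
  assumes "I \<inter> J = {}" "\<And>i. i \<notin> I \<Longrightarrow> i \<notin> J \<Longrightarrow> 0 < s i \<and> s i < 1"
  shows "cube_face_point I J s \<in> cube_face_interior I J"
  using assms by (auto simp: cube_face_point_def cube_face_interior_def cube_face_hull_def)

lemma cube_face_interior_nonempty:
  fixes I J :: "'n::finite set"
  assumes "I \<inter> J = {}"
  shows "cube_face_interior I J \<noteq> {}"
  using cube_face_point_in_interior[OF assms, of "\<lambda>_. 1/2"] by auto

text \<open>The face lies between a nonempty relatively open subset of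
  \<open>cube_face_hull I J\<close> and that affine space, which is a translate of the coordinate
  subspace of the free coordinates.\<close>

lemma aff_dim_cube_face:
  fixes I J :: "'n::finite set"
  assumes "I \<inter> J = {}"
  shows "aff_dim (cube_face I J) = int CARD('n) - int (card I) - int (card J)"
proof -
  obtain p where p: "p \<in> cube_face_interior I J" using cube_face_interior_nonempty[OF assms] by blast
  then have p_eq: "p $ i = 0" if "i \<in> I" for i using that by (simp add: cube_face_interior_def cube_face_hull_def)
  have p_eq': "p $ i = 1" if "i \<in> J" for i using p that by (simp add: cube_face_interior_def cube_face_hull_def)
  have "aff_dim (cube_face_interior I J) = aff_dim (cube_face_hull I J)"
    by (intro aff_dim_openin openin_cube_face_interior affine_cube_face_hull cube_face_interior_nonempty assms)
  moreover have "aff_dim (cube_face_interior I J) \<le> aff_dim (cube_face I J)"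
    "aff_dim (cube_face I J) \<le> aff_dim (cube_face_hull I J)"
    by (intro aff_dim_subset cube_face_interior_subset cube_face_subset_hull)+
  ultimately have "aff_dim (cube_face I J) = aff_dim (cube_face_hull I J)" by simp
  also have "cube_face_hull I J = (+) p ` {x. \<forall>i. i \<notin> - (I \<union> J) \<longrightarrow> x $ i = 0}" (is "_ = _ ` ?S")
  proof (intro equalityI subsetI)
    fix x assume "x \<in> cube_face_hull I J"
    then have "x - p \<in> ?S" by (auto simp: cube_face_hull_def p_eq p_eq')
    then show "x \<in> (+) p ` ?S" by (intro image_eqI[of _ _ "x - p"]) auto
  qed (auto simp: cube_face_hull_def p_eq p_eq')
  also have "aff_dim \<dots> = aff_dim ?S" by (rule aff_dim_translation_eq)
  also have "\<dots> = int (dim ?S)"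
    by (rule aff_dim_zero) (rule hull_inc, simp)
  also have "dim ?S = card (- (I \<union> J))" using dim_substandard_cart[of "- (I \<union> J)", where 'a=real] by (simp add: dim_vec_eq)
  also have "int (card (- (I \<union> J))) = int CARD('n) - int (card I) - int (card J)"
    using assms card_mono[of UNIV "I \<union> J"] by (simp add: card_Diff_subset Compl_eq_Diff_UNIV card_Un_disjoint of_nat_diff)
  finally show ?thesis .
qed

text \<open>The centre of a face, with all free coordinates 1/2, takes the values 0 and 1 exactly on
  the two index sets. Thus an inclusion of faces reverses to inclusions of index sets.\<close>

lemma inj_cube_face:
  fixes I J I' J' :: "'n::finite set"
  assumes "cube_face I J = cube_face I' J'" "I \<inter> J = {}" "I' \<inter> J' = {}"
  shows "I = I'" "J = J'"
proof -
  have "K \<subseteq> K' \<and> L \<subseteq> L'"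
    if "cube_face K' L' \<subseteq> cube_face K L" "K' \<inter> L' = {}" for K L K' L' :: "'n set"
  proof -
    have "cube_face_point K' L' (\<lambda>_. 1/2) \<in> cube_face K L"
      using that cube_face_interior_subset cube_face_point_in_interior[OF that(2), of "\<lambda>_. 1/2"] by fastforce
    then have "\<forall>i\<in>K. cube_face_point K' L' (\<lambda>_. 1/2) $ i = 0" "\<forall>i\<in>L. cube_face_point K' L' (\<lambda>_. 1/2) $ i = 1"
      by (auto simp: cube_face_def)
    then show ?thesis by (force simp: cube_face_point_def split: if_splits)
  qed
  from this[of I' J' I J] this[of I J I' J'] show "I = I'" "J = J'" using assms by auto
qed

text \<open>The values 0 and 1 are extreme in [0,1]: a convex combination with positive weights
  attains one of them only if both end points do.\<close>

lemma cube_face_face_of: "cube_face I J face_of (cube_face {} {} :: (real ^ 'n) set)"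
  unfolding face_of_def
proof (intro conjI ballI impI)
  show "cube_face I J \<subseteq> (cube_face {} {} :: (real ^ 'n) set)" by (auto simp: cube_face_def)
  have "cube_face I J = cube_face {} {} \<inter> (cube_face_hull I J :: (real ^ 'n) set)"
    by (auto simp: cube_face_def cube_face_hull_def)
  then show "convex (cube_face I J :: (real ^ 'n) set)"
    by (simp add: convex_Int polyhedron_imp_convex[OF polyhedron_cube] affine_imp_convex affine_cube_face_hull)
next
  fix a b x :: "real ^ 'n"
  assume a: "a \<in> cube_face {} {}" and b: "b \<in> cube_face {} {}" and x: "x \<in> cube_face I J" "x \<in> open_segment a b"
  then obtain u where u: "0 < u" "u < 1" "x = (1 - u) *\<^sub>R a + u *\<^sub>R b" by (auto simp: in_segment)
  have z: "a $ i = 0 \<and> b $ i = 0" if "i \<in> I" for i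
  proof -
    have "(1 - u) * a $ i + u * b $ i = 0" using x that u by (auto simp: cube_face_def)
    moreover have "(1 - u) * a $ i \<ge> 0" "u * b $ i \<ge> 0" using u a b by (auto simp: cube_face_def)
    ultimately have "(1 - u) * a $ i = 0" "u * b $ i = 0" by linarith+
    then show ?thesis using u by simp
  qed
  have o: "a $ i = 1 \<and> b $ i = 1" if "i \<in> J" for i
  proof -
    have "(1 - u) * (1 - a $ i) + u * (1 - b $ i) = 0"
      using x that u by (auto simp: cube_face_def algebra_simps)
    moreover have "(1 - u) * (1 - a $ i) \<ge> 0" "u * (1 - b $ i) \<ge> 0" using u a b by (auto simp: cube_face_def)
    ultimately have "(1 - u) * (1 - a $ i) = 0" "u * (1 - b $ i) = 0" by linarith+
    then show ?thesis using u by simp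
  qed
  show "a \<in> cube_face I J" "b \<in> cube_face I J" using a b z o by (auto simp: cube_face_def)
qed

text \<open>The index sets are read off from the coordinates equal to 0 or 1 at a relative interior
  point \<open>x\<close>. Then \<open>x\<close> is also relatively interior to
  \<open>cube_face I J\<close>, and the two faces agree.\<close>

lemma nonempty_faces_cube:
  fixes F :: "(real ^ 'n::finite) set"
  assumes "F \<in> nonempty_faces (cube_face {} {})"
  obtains I J where "I \<inter> J = {}" "F = cube_face I J"
proof -
  note F = nonempty_facesD[OF assms]
  then obtain x where x: "x \<in> rel_interior F" using rel_interior_eq_empty[of F] by auto
  then have xc: "x \<in> cube_face {} {}" using rel_interior_subset face_of_imp_subset[OF F(1)] by blast
  define I J where "I = {i. x $ i = 0}" and "J = {i. x $ i = 1}"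
  have "x \<in> cube_face_interior I J"
    using xc by (auto simp: I_def J_def cube_face_interior_def cube_face_hull_def cube_face_def less_le)
  then have "rel_interior F \<inter> rel_interior (cube_face I J) \<noteq> {}"
    using x cube_face_interior_subset_rel_interior by blast
  then have "F = cube_face I J" using face_of_eq[OF F(1) cube_face_face_of] by blast
  moreover have "I \<inter> J = {}" by (auto simp: I_def J_def)
  ultimately show ?thesis using that by blast
qed

section \<open>Faces of the hypersimplex crossing a hyperplane\<close>

text \<open>Writes the sum of the coordinates in \<open>A\<close> as an inner product, the form in
  which hyperplanes appear above.\<close>

definition indicator_vec :: "'n set \<Rightarrow> real ^ 'n" where
  "indicator_vec A = (\<chi> i. if i \<in> A then 1 else 0)"

lemma inner_indicator_vec: "indicator_vec A \<bullet> x = (\<Sum>i\<in>A. x $ i)"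
proof -
  have "indicator_vec A \<bullet> x = (\<Sum>i\<in>UNIV. if i \<in> A then x $ i else 0)"
    unfolding inner_vec_def by (rule sum.cong) (auto simp: indicator_vec_def)
  also have "\<dots> = (\<Sum>i\<in>A. x $ i)" using sum.inter_filter[of UNIV "\<lambda>i. x $ i" "\<lambda>i. i \<in> A"] by simp
  finally show ?thesis .
qed

lemma indicator_vec_nonzero: "A \<noteq> {} \<Longrightarrow> indicator_vec A \<noteq> 0"
  by (auto simp: indicator_vec_def vec_eq_iff)

lemma hypersimplex_eq: "hypersimplex k = cube_face {} {} \<inter> {x. indicator_vec UNIV \<bullet> x = real k}"
  by (auto simp: hypersimplex_def cube_face_def inner_indicator_vec)

lemma polyhedron_hypersimplex: "polyhedron (hypersimplex k)"
  unfolding hypersimplex_eq by (intro polyhedron_Int polyhedron_cube polyhedron_hyperplane)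

lemma sum_cube_face_bounds:
  fixes x :: "real ^ 'n::finite"
  assumes "x \<in> cube_face I J"
  shows "real (card (J \<inter> A)) \<le> (\<Sum>i\<in>A. x $ i)"
    and "(\<Sum>i\<in>A. x $ i) \<le> real (card A) - real (card (I \<inter> A))"
proof -
  have "real (card (J \<inter> A)) = (\<Sum>i\<in>A. if i \<in> J then 1 else 0)"
    by (simp add: sum.If_cases Int_commute)
  also have "\<dots> \<le> (\<Sum>i\<in>A. x $ i)" using assms by (intro sum_mono) (auto simp: cube_face_def)
  finally show "real (card (J \<inter> A)) \<le> (\<Sum>i\<in>A. x $ i)" .
  have "(\<Sum>i\<in>A. x $ i) \<le> (\<Sum>i\<in>A. 1 - (if i \<in> I then 1 else 0))"
    using assms by (intro sum_mono) (auto simp: cube_face_def)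
  also have "\<dots> = real (card A) - real (card (I \<inter> A))"
    by (simp add: sum_subtractf sum.If_cases Int_commute)
  finally show "(\<Sum>i\<in>A. x $ i) \<le> real (card A) - real (card (I \<inter> A))" .
qed

text \<open>The common value of the free coordinates in \<open>A\<close> that makes the
  \<open>A\<close>-sum equal to \<open>v\<close>: the denominator is the number of free coordinates
  in \<open>A\<close> when \<open>I\<close> and \<open>J\<close> are disjoint, the numerator what
  they still have to add up to.\<close>

definition slice_value :: "'n set \<Rightarrow> 'n set \<Rightarrow> 'n set \<Rightarrow> real \<Rightarrow> real" where
  "slice_value I J A v = (v - card (J \<inter> A)) / (real (card A) - card (I \<inter> A) - card (J \<inter> A))"

lemma slice_value_bounds:
  assumes "real (card (J \<inter> A)) < v" "v < real (card A) - real (card (I \<inter> A))"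
  shows "0 < slice_value I J A v" "slice_value I J A v < 1"
  using assms by (auto simp: slice_value_def divide_simps)

lemma sum_cube_face_point:
  fixes I J A :: "'n::finite set"
  assumes "I \<inter> J = {}" "real (card (J \<inter> A)) < v" "v < real (card A) - real (card (I \<inter> A))"
    and "\<And>i. i \<in> A \<Longrightarrow> s i = slice_value I J A v"
  shows "(\<Sum>i\<in>A. cube_face_point I J s $ i) = v"
proof -
  have "(\<Sum>i\<in>A. cube_face_point I J s $ i)
      = (\<Sum>i\<in>A. (if i \<in> J then 1 else 0)
          + slice_value I J A v * (1 - (if i \<in> I then 1 else 0) - (if i \<in> J then 1 else 0)))"
    using assms by (intro sum.cong) (auto simp: cube_face_point_def)
  also have "\<dots> = card (J \<inter> A) + slice_value I J A v * (real (card A) - card (I \<inter> A) - card (J \<inter> A))"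
    by (simp add: sum.distrib sum_distrib_left[symmetric] sum_subtractf sum.If_cases Int_commute)
  also have "\<dots> = v" using assms by (simp add: slice_value_def)
  finally show ?thesis .
qed

text \<open>The pairs \<open>(I, J)\<close> whose face of the hypersimplex of sum \<open>\<alpha> + \<beta>\<close> contains points with
  \<open>A\<close>-sum below and above \<open>\<alpha>\<close>.\<close>

definition crossing_index :: "'n set \<Rightarrow> nat \<Rightarrow> nat \<Rightarrow> ('n set \<times> 'n set) set" where
  "crossing_index A \<alpha> \<beta> = {(I, J). I \<inter> J = {} \<and>
     card (I \<inter> A) + \<alpha> < card A \<and> card (J \<inter> A) < \<alpha> \<and>
     card (I \<inter> - A) + \<beta> < card (- A) \<and> card (J \<inter> - A) < \<beta>}"

text \<open>The free coordinates are made constant on each block. A shift \<delta> moves weight from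
  the complement of \<open>A\<close> into \<open>A\<close> and keeps the total.\<close>

lemma crossing_index_interior_point:
  fixes A :: "'n::finite set"
  assumes IJ: "(I, J) \<in> crossing_index A \<alpha> \<beta>" and \<delta>: "- 1 < \<delta>" "\<delta> < 1"
  obtains x where "x \<in> cube_face_interior I J" "indicator_vec UNIV \<bullet> x = real (\<alpha> + \<beta>)"
    "indicator_vec A \<bullet> x = real \<alpha> + \<delta>"
proof -
  \<comment> \<open>Strict inequalities between integers leave a gap of at least 1, which a shift of
    modulus below 1 cannot close.\<close>
  have A: "real (card (J \<inter> A)) < \<alpha> + \<delta>" "\<alpha> + \<delta> < real (card A) - real (card (I \<inter> A))"
    and B: "real (card (J \<inter> - A)) < \<beta> - \<delta>" "\<beta> - \<delta> < real (card (- A)) - real (card (I \<inter> - A))"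
    and disj: "I \<inter> J = {}"
    using IJ \<delta> by (auto simp: crossing_index_def)
  define s where "s i = (if i \<in> A then slice_value I J A (\<alpha> + \<delta>) else slice_value I J (- A) (\<beta> - \<delta>))" for i
  let ?x = "cube_face_point I J s"
  have sA: "(\<Sum>i\<in>A. ?x $ i) = \<alpha> + \<delta>"
    by (rule sum_cube_face_point[OF disj A]) (simp add: s_def)
  have sB: "(\<Sum>i\<in>- A. ?x $ i) = \<beta> - \<delta>"
    by (rule sum_cube_face_point[OF disj B]) (simp add: s_def)
  have "(\<Sum>i\<in>UNIV. ?x $ i) = (\<Sum>i\<in>A. ?x $ i) + (\<Sum>i\<in>- A. ?x $ i)"
    by (subst sum.union_disjoint[symmetric]) (auto simp: Compl_partition)
  moreover have "?x \<in> cube_face_interior I J"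
    using slice_value_bounds[OF A] slice_value_bounds[OF B]
    by (intro cube_face_point_in_interior disj) (simp add: s_def)
  ultimately show ?thesis using that[of ?x] sA sB by (simp add: inner_indicator_vec)
qed

text \<open>A point with \<open>A\<close>-sum below \<alpha> has complementary sum above \<beta>,
  and conversely. Bounding both sums at a point below and at a point above yields the four
  inequalities.\<close>

lemma crossing_index_if_crosses:
  fixes A :: "'n::finite set"
  assumes "I \<inter> J = {}"
    and "crosses (indicator_vec A) (real \<alpha>) (cube_face I J \<inter> {x. indicator_vec UNIV \<bullet> x = real (\<alpha> + \<beta>)})"
  shows "(I, J) \<in> crossing_index A \<alpha> \<beta>"
proof -
  obtain x y where x: "x \<in> cube_face I J" "(\<Sum>i\<in>UNIV. x $ i) = \<alpha> + \<beta>" "(\<Sum>i\<in>A. x $ i) < \<alpha>"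
    and y: "y \<in> cube_face I J" "(\<Sum>i\<in>UNIV. y $ i) = \<alpha> + \<beta>" "(\<Sum>i\<in>A. y $ i) > \<alpha>"
    using assms(2) by (auto simp: crosses_def inner_indicator_vec)
  have split: "(\<Sum>i\<in>UNIV. z $ i) = (\<Sum>i\<in>A. z $ i) + (\<Sum>i\<in>- A. z $ i)" for z :: "real ^ 'n"
    by (subst sum.union_disjoint[symmetric]) (auto simp: Compl_partition)
  have "real (card (I \<inter> A)) + real \<alpha> < real (card A)" "real (card (J \<inter> A)) < real \<alpha>"
    "real (card (I \<inter> - A)) + real \<beta> < real (card (- A))" "real (card (J \<inter> - A)) < real \<beta>"
    using sum_cube_face_bounds[OF x(1), of A] sum_cube_face_bounds[OF y(1), of A]
      sum_cube_face_bounds[OF x(1), of "- A"] sum_cube_face_bounds[OF y(1), of "- A"]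
      x(2,3) y(2,3) split[of x] split[of y] by simp_all
  then show ?thesis using assms(1) unfolding crossing_index_def by (simp add: of_nat_add[symmetric] del: of_nat_add)
qed

text \<open>The hyperplane \<open>H\<close> has no nonempty face but itself, so faces of the
  hypersimplex correspond to cube faces whose relative interior meets \<open>H\<close>. It remains
  to decide which of them cross.\<close>

lemma crossing_faces_hypersimplex:
  fixes A :: "'n::finite set" and \<alpha> \<beta> :: nat
  defines "H \<equiv> {x. indicator_vec UNIV \<bullet> x = real (\<alpha> + \<beta>)}"
  shows "bij_betw (\<lambda>(I, J). cube_face I J \<inter> H) (crossing_index A \<alpha> \<beta>)
    {F \<in> nonempty_faces (hypersimplex (\<alpha> + \<beta>)). crosses (indicator_vec A) \<alpha> F}" (is "bij_betw ?f ?V ?C")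
proof (rule bij_betw_imageI)
  have nz: "indicator_vec (UNIV :: 'n set) \<noteq> 0" by (rule indicator_vec_nonzero) simp
  have facesH: "nonempty_faces H = {H}" unfolding H_def by (rule nonempty_faces_hyperplane[OF nz])
  have riH: "rel_interior H = H" unfolding H_def by (rule rel_interior_halfspaces[OF nz])
  have polyH: "polyhedron H" unfolding H_def by (rule polyhedron_hyperplane)
  have hyp: "hypersimplex (\<alpha> + \<beta>) = cube_face {} {} \<inter> H" unfolding H_def by (rule hypersimplex_eq)
  note bij = bij_betw_faces_Int[OF polyhedron_cube polyH, folded hyp, unfolded facesH]
  let ?P = "{(F, K). F \<in> nonempty_faces (cube_face {} {}) \<and> K \<in> {H} \<and> rel_interior F \<inter> rel_interior K \<noteq> {}}"
  have mem: "(cube_face I J, H) \<in> ?P" if IJ: "(I, J) \<in> ?V" for I J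
  proof -
    \<comment> \<open>The unshifted point, \<delta> = 0, lies on \<open>H\<close>.\<close>
    obtain x where x: "x \<in> cube_face_interior I J" "x \<in> H"
      using crossing_index_interior_point[OF IJ, of 0] unfolding H_def by auto
    then have "x \<in> rel_interior (cube_face I J) \<inter> rel_interior H" "x \<in> cube_face I J"
      using cube_face_interior_subset_rel_interior cube_face_interior_subset riH by blast+
    then show ?thesis using cube_face_face_of by (auto simp: nonempty_faces_def)
  qed
  show "inj_on ?f ?V"
  proof (rule inj_onI, clarify)
    fix I J I' J'
    assume V: "(I, J) \<in> ?V" "(I', J') \<in> ?V" and eq: "cube_face I J \<inter> H = cube_face I' J' \<inter> H"
    have "(cube_face I J, H) = (cube_face I' J', H)"
      using inj_onD[OF bij_betw_imp_inj_on[OF bij], of "(cube_face I J, H)" "(cube_face I' J', H)"]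
        mem[OF V(1)] mem[OF V(2)] eq by simp
    then show "I = I' \<and> J = J'"
      using V inj_cube_face[of I J I' J'] by (simp add: crossing_index_def)
  qed
  show "?f ` ?V = ?C"
  proof (intro equalityI subsetI)
    fix F assume "F \<in> ?f ` ?V"
    then obtain I J where IJ: "(I, J) \<in> ?V" "F = cube_face I J \<inter> H" by auto
    have mem_faces: "F \<in> nonempty_faces (hypersimplex (\<alpha> + \<beta>))"
      using bij_betw_apply[OF bij mem[OF IJ(1)]] IJ(2) by simp
    \<comment> \<open>The shifts -1/2 and 1/2 give points strictly below and strictly above
      \<alpha>.\<close>
    obtain x where x: "x \<in> cube_face_interior I J" "x \<in> H" "indicator_vec A \<bullet> x = real \<alpha> + (- 1/2)"
      by (rule crossing_index_interior_point[OF IJ(1), of "- 1/2"]) (simp_all add: H_def)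
    obtain y where y: "y \<in> cube_face_interior I J" "y \<in> H" "indicator_vec A \<bullet> y = real \<alpha> + 1/2"
      by (rule crossing_index_interior_point[OF IJ(1), of "1/2"]) (simp_all add: H_def)
    have "crosses (indicator_vec A) \<alpha> F"
      unfolding crosses_def IJ(2) using x y cube_face_interior_subset[of I J]
      by (intro conjI bexI[of _ x] bexI[of _ y]) auto
    with mem_faces show "F \<in> ?C" by simp
  next
    fix F assume F: "F \<in> ?C"
    then have "F \<in> (\<lambda>(Q, K). Q \<inter> K) ` ?P"
      unfolding bij_betw_imp_surj_on[OF bij] by blast
    then obtain Q where Q: "(Q, H) \<in> ?P" "F = Q \<inter> H" by blast
    from Q(1) have "Q \<in> nonempty_faces (cube_face {} {})" by blast
    then obtain I J where IJ: "I \<inter> J = {}" "Q = cube_face I J"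
      by (rule nonempty_faces_cube)
    have "(I, J) \<in> ?V"
      using crossing_index_if_crosses[OF IJ(1), of A \<alpha> \<beta>] F Q(2) IJ(2) unfolding H_def by simp
    then show "F \<in> ?f ` ?V" using Q(2) IJ(2) by (intro image_eqI[of _ _ "(I, J)"]) auto
  qed
qed

text \<open>The hyperplane of total sum meets the relative interior of the cube face without
  containing the face, so it costs exactly one dimension.\<close>

lemma aff_dim_crossing_face:
  fixes A :: "'n::finite set"
  assumes "(I, J) \<in> crossing_index A \<alpha> \<beta>"
  shows "aff_dim (cube_face I J \<inter> {x. indicator_vec UNIV \<bullet> x = real (\<alpha> + \<beta>)})
    = int CARD('n) - int (card I) - int (card J) - 1"
proof -
  let ?H = "{x :: real ^ 'n. indicator_vec UNIV \<bullet> x = real (\<alpha> + \<beta>)}"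
  have disj: "I \<inter> J = {}" using assms by (simp add: crossing_index_def)
  obtain x where "x \<in> cube_face_interior I J" "x \<in> ?H"
    using crossing_index_interior_point[OF assms, of 0] by auto
  then have "rel_interior (cube_face I J) \<inter> ?H \<noteq> {}"
    using cube_face_interior_subset_rel_interior by blast
  moreover have "\<not> cube_face I J \<subseteq> ?H"
  proof -
    \<comment> \<open>With all free coordinates 0 the sum is the size of \<open>J\<close>, which is
      less than \<alpha> + \<beta>.\<close>
    let ?p = "cube_face_point I J (\<lambda>_. 0)"
    have "?p \<in> cube_face I J" using disj by (auto simp: cube_face_def cube_face_point_def)
    have "(\<Sum>i\<in>UNIV. ?p $ i) = (\<Sum>i\<in>UNIV. if i \<in> J then 1 else 0)"
      using disj by (intro sum.cong) (auto simp: cube_face_point_def)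
    also have "\<dots> = real (card ((J \<inter> A) \<union> (J \<inter> - A)))" by (simp add: sum.If_cases Int_Un_distrib[symmetric])
    also have "\<dots> = real (card (J \<inter> A) + card (J \<inter> - A))" by (subst card_Un_disjoint) auto
    also have "\<dots> < real (\<alpha> + \<beta>)" using assms by (simp add: crossing_index_def)
    finally show ?thesis using \<open>?p \<in> cube_face I J\<close> by (auto simp: inner_indicator_vec)
  qed
  ultimately show ?thesis
    using aff_dim_Int_hyperplane_rel_interior aff_dim_cube_face[OF disj] by metis
qed

lemma sum_crossing_faces_hypersimplex:
  fixes A :: "'n::finite set"
  shows "(\<Sum>F | F \<in> nonempty_faces (hypersimplex (\<alpha> + \<beta>)) \<and> crosses (indicator_vec A) \<alpha> F. g (nat (aff_dim F)))
    = (\<Sum>(I, J)\<in>crossing_index A \<alpha> \<beta>. g (CARD('n) - card I - card J - 1))"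
  unfolding sum.reindex_bij_betw[OF crossing_faces_hypersimplex, symmetric]
proof (rule sum.cong[OF refl], clarify)
  fix I J :: "'n set"
  assume "(I, J) \<in> crossing_index A \<alpha> \<beta>"
  \<comment> \<open>\<open>nat\<close> and natural number subtraction both truncate at 0, so the two
    exponents agree.\<close>
  from aff_dim_crossing_face[OF this]
  have "nat (aff_dim (cube_face I J \<inter> {x. indicator_vec UNIV \<bullet> x = real (\<alpha> + \<beta>)}))
      = CARD('n) - card I - card J - 1"
    by arith
  then show "g (nat (aff_dim (cube_face I J \<inter> {x. indicator_vec UNIV \<bullet> x = real (\<alpha> + \<beta>)})))
      = g (CARD('n) - card I - card J - 1)"
    by (rule arg_cong)
qed

section \<open>Linear images and products\<close>

lemma f_poly_linear_image:
  fixes f :: "'u::euclidean_space \<Rightarrow> 'v::euclidean_space"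
  assumes f: "linear f" "inj f"
  shows "f_poly (f ` P) = f_poly P"
proof -
  have "face_number (f ` P) i = face_number P i" for i
  proof -
    have "{F. F face_of f ` P \<and> aff_dim F = int i} = image f ` {F. F face_of P \<and> aff_dim F = int i}"
    proof (intro equalityI subsetI)
      fix F assume F: "F \<in> {F. F face_of f ` P \<and> aff_dim F = int i}"
      then have "F \<in> image f ` {T. T face_of P}" unfolding faces_of_linear_image[OF f, symmetric] by simp
      then obtain T where "T face_of P" "F = f ` T" by blast
      then show "F \<in> image f ` {F. F face_of P \<and> aff_dim F = int i}"
        using F aff_dim_injective_linear_image[OF f, of T] by simp
    next
      fix F assume "F \<in> image f ` {F. F face_of P \<and> aff_dim F = int i}"
      then obtain T where "T face_of P" "aff_dim T = int i" "F = f ` T" by blast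
      then show "F \<in> {F. F face_of f ` P \<and> aff_dim F = int i}"
        using face_of_linear_image[OF f, of T P] aff_dim_injective_linear_image[OF f, of T] by simp
    qed
    moreover have "inj_on (image f) {F. F face_of P \<and> aff_dim F = int i}"
      using f(2) by (simp add: inj_on_def inj_image_eq_iff)
    ultimately show ?thesis unfolding face_number_def by (simp add: card_image)
  qed
  then show ?thesis by (simp add: f_poly_def aff_dim_injective_linear_image[OF f])
qed

section \<open>Products of polytopes\<close>

lemma polytope_Times:
  fixes S :: "'u::euclidean_space set" and T :: "'v::euclidean_space set"
  assumes "polytope S" "polytope T"
  shows "polytope (S \<times> T)"
proof -
  obtain u v where "finite u" "S = convex hull u" "finite v" "T = convex hull v"
    using assms unfolding polytope_def by blast
  then show ?thesis
    unfolding polytope_def by (intro exI[of _ "u \<times> v"]) (simp add: convex_hull_Times)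
qed

text \<open>After translating both factors to contain the origin, affine dimension is linear
  dimension. The product then contains a copy of each factor, whence its span is the product of the
  spans.\<close>

lemma aff_dim_Times:
  fixes S :: "'u::euclidean_space set" and T :: "'v::euclidean_space set"
  assumes "S \<noteq> {}" "T \<noteq> {}"
  shows "aff_dim (S \<times> T) = aff_dim S + aff_dim T"
proof -
  obtain a b where ab: "a \<in> S" "b \<in> T" using assms by blast
  define S' where "S' = (+) (- a) ` S"
  define T' where "T' = (+) (- b) ` T"
  have 0: "0 \<in> S'" "0 \<in> T'" using ab by (auto simp: S'_def T'_def intro: image_eqI)
  have "S' \<times> T' = (+) (- a, - b) ` (S \<times> T)"
    unfolding S'_def T'_def by (auto simp: image_iff)
  then have ST: "aff_dim (S \<times> T) = aff_dim (S' \<times> T')" by (simp only: aff_dim_translation_eq)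
  have "span (S' \<times> T') = span S' \<times> span T'"
  proof
    show "span (S' \<times> T') \<subseteq> span S' \<times> span T'"
      by (rule span_minimal) (auto intro: span_base subspace_Times subspace_span)
    have "span S' \<times> {0} \<subseteq> span (S' \<times> T')"
    proof -
      have "(\<lambda>x. (x, 0)) ` span S' = span ((\<lambda>x. (x, 0)) ` S')"
        by (rule linear_span_image[symmetric]) (intro linearI; simp)
      also have "\<dots> \<subseteq> span (S' \<times> T')" using 0 by (intro span_mono) auto
      finally show ?thesis by auto
    qed
    moreover have "{0} \<times> span T' \<subseteq> span (S' \<times> T')"
    proof -
      have "(\<lambda>y. (0, y)) ` span T' = span ((\<lambda>y. (0, y)) ` T')"
        by (rule linear_span_image[symmetric]) (intro linearI; simp)
      also have "\<dots> \<subseteq> span (S' \<times> T')" using 0 by (intro span_mono) auto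
      finally show ?thesis by auto
    qed
    ultimately show "span S' \<times> span T' \<subseteq> span (S' \<times> T')"
    proof clarify
      fix x y
      assume "span S' \<times> {0} \<subseteq> span (S' \<times> T')" "{0} \<times> span T' \<subseteq> span (S' \<times> T')" "x \<in> span S'" "y \<in> span T'"
      then have "(x, 0) + (0, y) \<in> span (S' \<times> T')" by (intro span_add) auto
      then show "(x, y) \<in> span (S' \<times> T')" by simp
    qed
  qed
  then have "dim (S' \<times> T') = dim S' + dim T'"
    by (metis dim_span dim_Times subspace_span)
  moreover have "aff_dim (S' \<times> T') = int (dim (S' \<times> T'))" "aff_dim S' = int (dim S')" "aff_dim T' = int (dim T')"
    using 0 by (auto intro!: aff_dim_zero hull_inc simp: zero_prod_def)
  moreover have "aff_dim S' = aff_dim S" "aff_dim T' = aff_dim T"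
    unfolding S'_def T'_def by (rule aff_dim_translation_eq)+
  ultimately show ?thesis using ST by simp
qed

text \<open>Faces of a product are products of faces. Nonemptiness gives injectivity, as a product
  with an empty factor does not determine the other one.\<close>

lemma nonempty_faces_Times:
  fixes S :: "'u::euclidean_space set" and T :: "'v::euclidean_space set"
  shows "bij_betw (\<lambda>(F, G). F \<times> G) (nonempty_faces S \<times> nonempty_faces T) (nonempty_faces (S \<times> T))"
proof (rule bij_betw_imageI)
  show "inj_on (\<lambda>(F, G). F \<times> G) (nonempty_faces S \<times> nonempty_faces T)"
    by (auto simp: inj_on_def nonempty_faces_def times_eq_iff)
  show "(\<lambda>(F, G). F \<times> G) ` (nonempty_faces S \<times> nonempty_faces T) = nonempty_faces (S \<times> T)"
    unfolding nonempty_faces_def face_of_Times_decomp by (auto simp: image_iff)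
qed

lemma f_poly_Times:
  fixes S :: "'u::euclidean_space set" and T :: "'v::euclidean_space set"
  assumes "polytope S" "polytope T"
  shows "f_poly (S \<times> T) = f_poly S * f_poly T"
proof -
  have "f_poly (S \<times> T) = (\<Sum>(F, G)\<in>nonempty_faces S \<times> nonempty_faces T. monom 1 (nat (aff_dim (F \<times> G))))"
    using sum.reindex_bij_betw[OF nonempty_faces_Times, of "\<lambda>H. monom (1::int) (nat (aff_dim H))" S T]
    by (simp add: f_poly_eq_sum_faces[OF polytope_imp_polyhedron[OF polytope_Times[OF assms]]] case_prod_unfold)
  also have "\<dots> = (\<Sum>(F, G)\<in>nonempty_faces S \<times> nonempty_faces T. monom 1 (nat (aff_dim F)) * monom 1 (nat (aff_dim G)))"
  proof (rule sum.cong[OF refl], clarify)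
    fix F G assume "F \<in> nonempty_faces S" "G \<in> nonempty_faces T"
    then have ne: "F \<noteq> {}" "G \<noteq> {}" by (simp_all add: nonempty_faces_def)
    then have "0 \<le> aff_dim F" "0 \<le> aff_dim G"
      using aff_dim_negative_iff[of F] aff_dim_negative_iff[of G] by linarith+
    then show "monom (1::int) (nat (aff_dim (F \<times> G))) = monom 1 (nat (aff_dim F)) * monom 1 (nat (aff_dim G))"
      using ne by (simp add: aff_dim_Times mult_monom nat_add_distrib)
  qed
  also have "\<dots> = f_poly S * f_poly T"
    using assms by (simp add: f_poly_eq_sum_faces polytope_imp_polyhedron sum_product sum.cartesian_product)
  finally show ?thesis .
qed

section \<open>Counting crossing faces\<close>

definition disjoint_pairs :: "'n set \<Rightarrow> nat \<Rightarrow> nat \<Rightarrow> ('n set \<times> 'n set) set" where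
  "disjoint_pairs S i j = {(I, J). I \<subseteq> S \<and> J \<subseteq> S \<and> I \<inter> J = {} \<and> card I = i \<and> card J = j}"

text \<open>Multiplying the factorial formulas of the two binomials cancels
  \<open>fact (n - i)\<close> and shows that the division is exact.\<close>

lemma multinom_eq_binomial:
  assumes "i + j \<le> n"
  shows "multinom n i j = (n choose i) * ((n - i) choose j)"
proof -
  have "fact i * fact (n - i) * (n choose i) = (fact n :: nat)"
    "fact j * fact (n - i - j) * ((n - i) choose j) = (fact (n - i) :: nat)"
    using assms by (intro binomial_fact_lemma; simp)+
  then have "fact n = (n choose i) * ((n - i) choose j) * (fact i * fact j * fact (n - i - j) :: nat)"
    by (metis mult.assoc mult.commute)
  then show ?thesis unfolding multinom_def by simp
qed

text \<open>Choose \<open>I\<close> in \<open>S\<close> first, then \<open>J\<close> in the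
  rest.\<close>

lemma card_disjoint_pairs:
  assumes "finite S" "i + j \<le> card S"
  shows "card (disjoint_pairs S i j) = multinom (card S) i j"
proof -
  have "disjoint_pairs S i j = (SIGMA I:{I. I \<subseteq> S \<and> card I = i}. {J. J \<subseteq> S - I \<and> card J = j})"
    by (auto simp: disjoint_pairs_def)
  also have "card \<dots> = (\<Sum>I | I \<subseteq> S \<and> card I = i. card {J. J \<subseteq> S - I \<and> card J = j})"
    using assms(1) by (intro card_SigmaI) auto
  also have "\<dots> = (\<Sum>I | I \<subseteq> S \<and> card I = i. (card S - i) choose j)"
    using assms(1) by (intro sum.cong refl) (auto simp: n_subsets card_Diff_subset finite_subset)
  also have "\<dots> = (card S choose i) * ((card S - i) choose j)"
    using assms(1) by (simp add: n_subsets)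
  finally show ?thesis using multinom_eq_binomial[OF assms(2)] by simp
qed

text \<open>A disjoint pair is the same as a disjoint pair of traces on \<open>A\<close> together
  with an independent one on the complement.\<close>

lemma card_pairs_split:
  fixes A :: "'n::finite set"
  shows "card {(I, J). I \<inter> J = {} \<and> card (I \<inter> A) = i \<and> card (J \<inter> A) = j \<and>
      card (I \<inter> - A) = i' \<and> card (J \<inter> - A) = j'}
    = card (disjoint_pairs A i j) * card (disjoint_pairs (- A) i' j')" (is "card ?V = _")
proof -
  have "bij_betw (\<lambda>(I, J). ((I \<inter> A, J \<inter> A), (I \<inter> - A, J \<inter> - A))) ?V
    (disjoint_pairs A i j \<times> disjoint_pairs (- A) i' j')"
  proof (rule bij_betwI[where g = "\<lambda>((I, J), (I', J')). (I \<union> I', J \<union> J')"])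
    show "(\<lambda>(I, J). ((I \<inter> A, J \<inter> A), (I \<inter> - A, J \<inter> - A))) \<in> ?V \<rightarrow> disjoint_pairs A i j \<times> disjoint_pairs (- A) i' j'"
      by (auto simp: disjoint_pairs_def)
    have *: "(I \<union> I') \<inter> A = I" "(I \<union> I') \<inter> - A = I'" if "I \<subseteq> A" "I' \<subseteq> - A" for I I' :: "'n set"
      using that by auto
    show "(\<lambda>((I, J), (I', J')). (I \<union> I', J \<union> J')) \<in> disjoint_pairs A i j \<times> disjoint_pairs (- A) i' j' \<rightarrow> ?V"
    proof (rule Pi_I, clarify)
      fix I J I' J' assume "(I, J) \<in> disjoint_pairs A i j" "(I', J') \<in> disjoint_pairs (- A) i' j'"
      then have h: "I \<subseteq> A" "J \<subseteq> A" "I \<inter> J = {}" "card I = i" "card J = j"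
        "I' \<subseteq> - A" "J' \<subseteq> - A" "I' \<inter> J' = {}" "card I' = i'" "card J' = j'"
        by (simp_all add: disjoint_pairs_def)
      have "(I \<union> I') \<inter> (J \<union> J') = {}" using h by blast
      then show "(I \<union> I') \<inter> (J \<union> J') = {} \<and> card ((I \<union> I') \<inter> A) = i \<and> card ((J \<union> J') \<inter> A) = j \<and>
          card ((I \<union> I') \<inter> - A) = i' \<and> card ((J \<union> J') \<inter> - A) = j'"
        using h *[of I I'] *[of J J'] by simp
    qed
    fix p assume "p \<in> ?V"
    have "(I \<inter> A) \<union> (I \<inter> - A) = I" for I by blast
    then show "(\<lambda>((I, J), (I', J')). (I \<union> I', J \<union> J')) ((\<lambda>(I, J). ((I \<inter> A, J \<inter> A), (I \<inter> - A, J \<inter> - A))) p) = p"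
      by (simp add: case_prod_unfold)
  next
    fix q assume "q \<in> disjoint_pairs A i j \<times> disjoint_pairs (- A) i' j'"
    then obtain I J I' J' where "q = ((I, J), (I', J'))" "I \<subseteq> A" "J \<subseteq> A" "I' \<subseteq> - A" "J' \<subseteq> - A"
      by (auto simp: disjoint_pairs_def)
    moreover have "(I \<union> I') \<inter> A = I" "(I \<union> I') \<inter> - A = I'" if "I \<subseteq> A" "I' \<subseteq> - A" for I I' :: "'n set"
      using that by auto
    ultimately show "(\<lambda>(I, J). ((I \<inter> A, J \<inter> A), (I \<inter> - A, J \<inter> - A))) ((\<lambda>((I, J), (I', J')). (I \<union> I', J \<union> J')) q) = q"
      by simp
  qed
  then show ?thesis using bij_betw_same_card by (fastforce simp: card_cartesian_product)
qed

text \<open>Group the pairs by the four sizes of their traces. On each group the summand is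
  constant, and the size of the group is a product of two multinomial coefficients.\<close>

lemma sum_crossing_index:
  fixes A :: "'n::finite set" and g :: "nat \<Rightarrow> nat \<Rightarrow> int poly"
  assumes "0 < \<alpha>" "\<alpha> < card A" "0 < \<beta>" "\<beta> < card (- A)"
  shows "(\<Sum>(I, J)\<in>crossing_index A \<alpha> \<beta>. g (card I) (card J))
    = (\<Sum>i = 0..card A - \<alpha> - 1. \<Sum>j = 0..\<alpha> - 1. \<Sum>i' = 0..card (- A) - \<beta> - 1. \<Sum>j' = 0..\<beta> - 1.
        of_nat (multinom (card A) i j) * of_nat (multinom (card (- A)) i' j') * g (i + i') (j + j'))"
proof -
  define key where "key = (\<lambda>(I, J). (card (I \<inter> A), card (J \<inter> A), card (I \<inter> - A), card (J \<inter> - A)))"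
  let ?K = "{0..card A - \<alpha> - 1} \<times> {0..\<alpha> - 1} \<times> {0..card (- A) - \<beta> - 1} \<times> {0..\<beta> - 1}"
  let ?V = "crossing_index A \<alpha> \<beta>"
  have split: "card I = card (I \<inter> A) + card (I \<inter> - A)" for I
  proof -
    have "I = (I \<inter> A) \<union> (I \<inter> - A)" by blast
    then have "card I = card ((I \<inter> A) \<union> (I \<inter> - A))" by simp
    also have "\<dots> = card (I \<inter> A) + card (I \<inter> - A)" by (rule card_Un_disjoint) auto
    finally show ?thesis .
  qed
  have fibre: "(\<Sum>p | p \<in> ?V \<and> key p = (i, j, i', j'). (\<lambda>(I, J). g (card I) (card J)) p)
      = of_nat (multinom (card A) i j) * of_nat (multinom (card (- A)) i' j') * g (i + i') (j + j')"
    if "(i, j, i', j') \<in> ?K" for i j i' j'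
  proof -
    \<comment> \<open>The positivity assumptions make the truncated upper limits equivalent to these
      strict inequalities, which in turn make the size conditions of \<open>crossing_index\<close>
      automatic on the fibre.\<close>
    have bnd: "i + \<alpha> < card A" "j < \<alpha>" "i' + \<beta> < card (- A)" "j' < \<beta>" using that assms by auto
    have eq: "{p. p \<in> ?V \<and> key p = (i, j, i', j')} = {(I, J). I \<inter> J = {} \<and> card (I \<inter> A) = i \<and> card (J \<inter> A) = j \<and>
      card (I \<inter> - A) = i' \<and> card (J \<inter> - A) = j'}"
      using bnd by (auto simp: key_def crossing_index_def)
    have "(\<Sum>p | p \<in> ?V \<and> key p = (i, j, i', j'). (\<lambda>(I, J). g (card I) (card J)) p)
      = (\<Sum>p | p \<in> ?V \<and> key p = (i, j, i', j'). g (i + i') (j + j'))"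
    proof (rule sum.cong[OF refl])
      fix p assume "p \<in> {p. p \<in> ?V \<and> key p = (i, j, i', j')}"
      moreover obtain I J where "p = (I, J)" by (cases p)
      ultimately show "(\<lambda>(I, J). g (card I) (card J)) p = g (i + i') (j + j')"
        using split[of I] split[of J] by (simp add: key_def)
    qed
    also have "\<dots> = of_nat (multinom (card A) i j * multinom (card (- A)) i' j') * g (i + i') (j + j')"
      unfolding eq using bnd by (simp add: card_pairs_split card_disjoint_pairs)
    finally show ?thesis by simp
  qed
  have "(\<Sum>p\<in>?V. (\<lambda>(I, J). g (card I) (card J)) p)
      = (\<Sum>k\<in>?K. \<Sum>p | p \<in> ?V \<and> key p = k. (\<lambda>(I, J). g (card I) (card J)) p)"
    by (rule sum.group[symmetric]) (auto simp: key_def crossing_index_def)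
  also have "\<dots> = (\<Sum>(i, j, i', j')\<in>?K.
      of_nat (multinom (card A) i j) * of_nat (multinom (card (- A)) i' j') * g (i + i') (j + j'))"
  proof (rule sum.cong[OF refl])
    fix k assume k: "k \<in> ?K"
    obtain i j i' j' where "k = (i, j, i', j')" by (cases k) auto
    then show "(\<Sum>p | p \<in> ?V \<and> key p = k. (\<lambda>(I, J). g (card I) (card J)) p) = (case k of (i, j, i', j') \<Rightarrow>
      of_nat (multinom (card A) i j) * of_nat (multinom (card (- A)) i' j') * g (i + i') (j + j'))"
      using fibre k by simp
  qed
  finally show ?thesis by (simp only: sum.cartesian_product)
qed

section \<open>The polynomial w\<close>

definition join_vec :: "(real ^ 'a::finite) \<times> (real ^ 'b::finite) \<Rightarrow> real ^ ('a + 'b)" where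
  "join_vec p = (\<chi> s. case s of Inl i \<Rightarrow> fst p $ i | Inr j \<Rightarrow> snd p $ j)"

definition swap_vec :: "real ^ ('b::finite + 'a::finite) \<Rightarrow> real ^ ('a + 'b)" where
  "swap_vec x = (\<chi> s. case s of Inl i \<Rightarrow> x $ Inr i | Inr j \<Rightarrow> x $ Inl j)"

lemma join_vec_nth [simp]: "join_vec p $ Inl i = fst p $ i" "join_vec p $ Inr j = snd p $ j"
  by (simp_all add: join_vec_def)

lemma swap_vec_nth [simp]: "swap_vec x $ Inl i = x $ Inr i" "swap_vec x $ Inr j = x $ Inl j"
  by (simp_all add: swap_vec_def)

lemma vec_sum_eq_iff: "x = y \<longleftrightarrow> (\<forall>i. x $ Inl i = y $ Inl i) \<and> (\<forall>j. x $ Inr j = y $ Inr j)"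
  for x y :: "'c ^ ('a::finite + 'b::finite)"
  by (metis vec_eq_iff sum.exhaust)

lemma linear_join_vec: "linear (join_vec :: (real ^ 'a::finite) \<times> (real ^ 'b::finite) \<Rightarrow> _)"
  by (intro linearI) (simp_all add: vec_sum_eq_iff)

lemma inj_join_vec: "inj (join_vec :: (real ^ 'a::finite) \<times> (real ^ 'b::finite) \<Rightarrow> _)"
  by (rule injI) (simp add: vec_sum_eq_iff prod_eq_iff vec_eq_iff)

lemma linear_swap_vec: "linear (swap_vec :: real ^ ('b::finite + 'a::finite) \<Rightarrow> _)"
  by (intro linearI) (simp_all add: vec_sum_eq_iff)

lemma swap_swap_vec: "swap_vec (swap_vec x) = x"
  by (simp add: vec_sum_eq_iff)

lemma inj_swap_vec: "inj (swap_vec :: real ^ ('b::finite + 'a::finite) \<Rightarrow> _)"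
  by (metis injI swap_swap_vec)

lemma sum_UNIV_sum: "(\<Sum>s\<in>UNIV. f s) = (\<Sum>i\<in>UNIV. f (Inl i)) + (\<Sum>j\<in>UNIV. f (Inr j))"
  for f :: "'a::finite + 'b::finite \<Rightarrow> real"
  by (simp add: UNIV_Plus_UNIV[symmetric] sum.Plus del: UNIV_Plus_UNIV)

lemma inner_indicator_range_Inl:
  "indicator_vec (range Inl) \<bullet> x = (\<Sum>i\<in>UNIV. x $ (Inl i :: 'a::finite + 'b::finite))"
  by (simp add: inner_indicator_vec sum.reindex)

lemma hypersimplex_sum_iff:
  "x \<in> hypersimplex k \<longleftrightarrow> (\<forall>i. 0 \<le> x $ Inl i \<and> x $ Inl i \<le> 1) \<and> (\<forall>j. 0 \<le> x $ Inr j \<and> x $ Inr j \<le> 1) \<and>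
    (\<Sum>i\<in>UNIV. x $ Inl i) + (\<Sum>j\<in>UNIV. x $ Inr j) = real k"
  for x :: "real ^ ('a::finite + 'b::finite)"
  unfolding hypersimplex_def mem_Collect_eq sum_UNIV_sum by (metis (no_types, lifting) sum.exhaust)

section \<open>The polytopes in the definition of w as pieces of the cut hypersimplex\<close>

lemma split_polytope_eq:
  "split_polytope r k = hypersimplex k \<inter> {x :: real ^ ('a::finite + 'b::finite). indicator_vec (range Inl) \<bullet> x \<le> real r}"
  by (auto simp: split_polytope_def inner_indicator_range_Inl)

lemma image_swap_vec: "swap_vec ` S = {x. swap_vec x \<in> S}"
proof (intro equalityI subsetI)
  fix x assume "x \<in> {x. swap_vec x \<in> S}"
  then show "x \<in> swap_vec ` S" by (intro image_eqI[of _ _ "swap_vec x"]) (simp_all add: swap_swap_vec)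
qed (auto simp: swap_swap_vec)

lemma swap_vec_hypersimplex:
  "swap_vec ` (hypersimplex k :: (real ^ ('b::finite + 'a::finite)) set) = hypersimplex k"
  by (auto simp: image_swap_vec hypersimplex_sum_iff add.commute)

text \<open>As the total is \<alpha> + \<beta>, a sum of at most \<beta> over one block means a sum
  of at least \<alpha> over the other.\<close>

lemma swap_vec_split_polytope:
  "swap_vec ` (split_polytope \<beta> (\<alpha> + \<beta>) :: (real ^ ('b::finite + 'a::finite)) set)
    = hypersimplex (\<alpha> + \<beta>) \<inter> {x. indicator_vec (range Inl) \<bullet> x \<ge> real \<alpha>}"
  unfolding split_polytope_def image_swap_vec inner_indicator_range_Inl
  by (auto simp: hypersimplex_sum_iff)

text \<open>Fixing the first block sum to \<alpha> forces the second to be \<beta>, so the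
  conditions on the two blocks decouple.\<close>

lemma join_vec_hypersimplex:
  "join_vec ` ((hypersimplex \<alpha> :: (real ^ 'a::finite) set) \<times> (hypersimplex \<beta> :: (real ^ 'b::finite) set))
    = hypersimplex (\<alpha> + \<beta>) \<inter> {x. indicator_vec (range Inl) \<bullet> x = real \<alpha>}"
proof (intro equalityI subsetI)
  fix x :: "real ^ ('a + 'b)"
  assume x: "x \<in> hypersimplex (\<alpha> + \<beta>) \<inter> {x. indicator_vec (range Inl) \<bullet> x = real \<alpha>}"
  let ?p = "(\<chi> i. x $ Inl i, \<chi> j. x $ Inr j)"
  have "x = join_vec ?p" by (simp add: vec_sum_eq_iff)
  moreover have "?p \<in> hypersimplex \<alpha> \<times> hypersimplex \<beta>"
    using x by (auto simp: hypersimplex_sum_iff inner_indicator_range_Inl) (auto simp: hypersimplex_def)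
  ultimately show "x \<in> join_vec ` (hypersimplex \<alpha> \<times> hypersimplex \<beta>)" by (rule image_eqI)
next
  fix x :: "real ^ ('a + 'b)"
  assume "x \<in> join_vec ` (hypersimplex \<alpha> \<times> hypersimplex \<beta>)"
  then show "x \<in> hypersimplex (\<alpha> + \<beta>) \<inter> {x. indicator_vec (range Inl) \<bullet> x = real \<alpha>}"
    by (auto simp: hypersimplex_sum_iff inner_indicator_range_Inl) (auto simp: hypersimplex_def)
qed

lemma polytope_hypersimplex: "polytope (hypersimplex k)"
  unfolding hypersimplex_eq cube_face_eq_cbox
  by (intro polytope_Int_polyhedron polytope_interval polyhedron_hyperplane)

text \<open>Expanding both \<open>u_poly\<close> terms leaves the two halves minus the hypersimplex
  and minus the product, to which \<open>f_poly_cut\<close> applies.\<close>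

lemma w_poly_eq_sum_crossing_faces:
  "w_poly TYPE('a::finite) TYPE('b::finite) \<alpha> \<beta>
    = (\<Sum>F | F \<in> nonempty_faces (hypersimplex (\<alpha> + \<beta>)) \<and>
        crosses (indicator_vec (range Inl :: ('a + 'b) set)) \<alpha> F. [:1, 1:] * monom 1 (nat (aff_dim F) - 1))"
proof -
  let ?A = "range Inl :: ('a + 'b) set"
  let ?\<Delta> = "hypersimplex (\<alpha> + \<beta>) :: (real ^ ('a + 'b)) set"
  have cut: "f_poly (?\<Delta> \<inter> {x. indicator_vec ?A \<bullet> x \<le> \<alpha>}) + f_poly (?\<Delta> \<inter> {x. indicator_vec ?A \<bullet> x \<ge> \<alpha>})
    = f_poly ?\<Delta> + f_poly (?\<Delta> \<inter> {x. indicator_vec ?A \<bullet> x = \<alpha>})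
      + (\<Sum>F | F \<in> nonempty_faces ?\<Delta> \<and> crosses (indicator_vec ?A) \<alpha> F. [:1, 1:] * monom 1 (nat (aff_dim F) - 1))"
    by (intro f_poly_cut polyhedron_hypersimplex indicator_vec_nonzero) simp
  have prod: "f_poly (?\<Delta> \<inter> {x. indicator_vec ?A \<bullet> x = \<alpha>})
      = f_poly (hypersimplex \<alpha> :: (real ^ 'a) set) * f_poly (hypersimplex \<beta> :: (real ^ 'b) set)"
    unfolding join_vec_hypersimplex[symmetric] f_poly_linear_image[OF linear_join_vec inj_join_vec]
    by (intro f_poly_Times polytope_hypersimplex)
  have ge: "f_poly (?\<Delta> \<inter> {x. indicator_vec ?A \<bullet> x \<ge> \<alpha>})
      = f_poly (split_polytope \<beta> (\<alpha> + \<beta>) :: (real ^ ('b + 'a)) set)"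
    unfolding swap_vec_split_polytope[symmetric] by (rule f_poly_linear_image[OF linear_swap_vec inj_swap_vec])
  \<comment> \<open>The last \<open>u_poly\<close> term contains the hypersimplex with its blocks
    exchanged, formally a polytope in another space.\<close>
  have swap: "f_poly ?\<Delta> = f_poly (hypersimplex (\<alpha> + \<beta>) :: (real ^ ('b + 'a)) set)"
    unfolding swap_vec_hypersimplex[symmetric, where 'b='b and 'a='a]
    by (rule f_poly_linear_image[OF linear_swap_vec inj_swap_vec])
  show ?thesis
    using cut unfolding w_poly_def u_poly_def prod ge split_polytope_eq[of \<alpha>, symmetric] swap
    by (simp only: algebra_simps)
qed

theorem proposition2p7:
  fixes \<alpha> \<beta> a b :: nat
  assumes "0 < \<alpha>" and "\<alpha> < a" and "0 < \<beta>" and "\<beta> < b"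
    and "CARD('a::finite) = a" and "CARD('b::finite) = b"
  shows "w_poly TYPE('a) TYPE('b) \<alpha> \<beta> =
    (\<Sum>i = 0..a - \<alpha> - 1. \<Sum>j = 0..\<alpha> - 1. \<Sum>i' = 0..b - \<beta> - 1. \<Sum>j' = 0..\<beta> - 1.
       of_nat (multinom a i j) * of_nat (multinom b i' j')
         * ([:1, 1:] * monom 1 (a + b - i - j - i' - j' - 2)))"
proof -
  let ?A = "range Inl :: ('a + 'b) set"
  have "- ?A = range Inr" by (auto simp: image_iff) (metis sum.exhaust)
  then have A: "card ?A = a" "card (- ?A) = b" using assms by (simp_all add: card_image)
  have ab: "CARD('a + 'b) = a + b" using assms by simp
  \<comment> \<open>One of the two units subtracted comes from the hyperplane of total sum, the
    other from the factor (1 + t) t^(d-1).\<close>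
  have ex: "a + b - (i + i') - (j + j') - 1 - 1 = a + b - i - j - i' - j' - 2" for i j i' j' by simp
  have "w_poly TYPE('a) TYPE('b) \<alpha> \<beta>
      = (\<Sum>(I, J)\<in>crossing_index ?A \<alpha> \<beta>. [:1, 1:] * monom 1 (a + b - card I - card J - 1 - 1))"
    unfolding w_poly_eq_sum_crossing_faces
    using sum_crossing_faces_hypersimplex[where A = ?A and \<alpha> = \<alpha> and \<beta> = \<beta>
        and g = "\<lambda>d. [:1, 1:] * monom (1::int) (d - 1)"]
    unfolding ab .
  also have "\<dots> = (\<Sum>i = 0..a - \<alpha> - 1. \<Sum>j = 0..\<alpha> - 1. \<Sum>i' = 0..b - \<beta> - 1. \<Sum>j' = 0..\<beta> - 1.
       of_nat (multinom a i j) * of_nat (multinom b i' j')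
         * ([:1, 1:] * monom 1 (a + b - (i + i') - (j + j') - 1 - 1)))"
    using sum_crossing_index[where A = ?A and \<alpha> = \<alpha> and \<beta> = \<beta>
        and g = "\<lambda>i j. [:1, 1:] * monom (1::int) (a + b - i - j - 1 - 1)"] assms(1-4)
    unfolding A .
  finally show ?thesis unfolding ex .
qed

end
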